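(* Let $U$ be an $n\times n$ matrix of the form $$U=\sum_{s=0}^k D_{C_s}F(\mathcal R_s)+D_{\Gamma_s}D_{p_s}F(\mathcal R_s)D_{q_s},$$ where $\mathcal R_0\prec\cdots\prec\mathcal R_k$ is a filtration of $\{1,\dots,n\}$ with $\mathcal R_0$ the trivial partition and $\mathcal R_k$ the partition into singletons, $C_s,\Gamma_s$ are nonnegative $\mathcal R_s$-measurable vectors, $\Gamma_k=0$, and for $s\le k-1$ $\{p_s,q_s\}$ is an $\mathcal R_{s+1}$-measurable partition. Let $\mathbb E_s$, $c_s$, $\gamma_s$, $\rho_s$ be as defined in the context. Assume that for $s=k-1,\dots,0$ $$\rho_s\gamma_s\le\sum_{r=s+1}^k c_r.$$ Then the backward recursion, for $s=k-1,\dots,0$, $$\frac1{d_s}=\mathbb E_s\!\left(\frac1{c_{s+1}+d_{s+1}}\right)-\gamma_s\,\mathbb E_s\!\left(\frac{p_s}{c_{s+1}+d_{s+1}}\right)\mathbb E_s\!\left(\frac{q_s}{c_{s+1}+d_{s+1}}\right),\qquad d_k=\mathbf 1,$$ has a nonnegative solution, and it satisfies $\rho_s\gamma_s\le c_{s+1}+d_{s+1}$ for $s=k-1,\dots,0$. In particular, $\mathbb I+tU$ is a bi-potential for all $t\ge 0$, and $U$ is a bi-potential if it is nonsingular.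
   Context: A partition $\mathcal R$ of $\{1,\dots,n\}$ has atoms (its blocks); $\mathcal R\prec\mathcal Q$ means $\mathcal R\ne\mathcal Q$ and every atom of $\mathcal Q$ is contained in an atom of $\mathcal R$. A filtration is a strictly increasing sequence $\mathcal R_0\prec\cdots\prec\mathcal R_k$. $F(\mathcal R)$ is the $0/1$ matrix with $F(\mathcal R)_{ij}=1$ iff $i,j$ are in the same atom of $\mathcal R$. A vector is $\mathcal R$-measurable if it is constant on atoms of $\mathcal R$. $\{p_s,q_s\}$ is an $\mathcal R_{s+1}$-measurable partition if $p_s,q_s$ are $\{0,1\}$-valued $\mathcal R_{s+1}$-measurable vectors with $p_s\odot q_s=0$ and $p_s+q_s=\mathbf 1$. $D_v$ is the diagonal matrix with diagonal $v$; $\odot$ is the entrywise product; $\mathbb I$ is the identity matrix; $\mathbf 1$ is the vector of ones. Since $\Gamma_k=0$, the term with $p_k,q_k$ is absent. $\mathbb E_s=D_{F(\mathcal R_s)\mathbf 1}^{-1}F(\mathcal R_s)$ is the conditional expectation (averaging over atoms) for $\mathcal R_s$, and $\mathbb E_s(v)$ is the vector obtained by applying it to $v$; $c_s=C_s\odot F(\mathcal R_s)\mathbf 1$, $\gamma_s=\Gamma_s\odot F(\mathcal R_s)\mathbf 1$; $\rho_s=\mathbb E_s(p_s)p_s+\mathbb E_s(q_s)q_s$. Products, quotients and inequalities of vectors are componentwise. Components of $d_s$ may a priori take the value $\infty$ ($1/\infty=0$). A nonnegative matrix $V$ is a bi-potential if it is nonsingular and $(V^{-1})_{ij}\le 0$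 for $i\neq j$, $(V^{-1})_{ii}>0$, $\sum_j (V^{-1})_{ij}\ge 0$ for every $i$, and $\sum_i (V^{-1})_{ij}\ge 0$ for every $j$. *)

theory Defs
  imports "HOL-Analysis.Analysis" "HOL-Library.Disjoint_Sets" "HOL-Library.Extended_Real"
begin

text \<open>
  The index set \<open>{1,\<dots>,n}\<close> is a finite type \<open>'n\<close>, and a partition of it is the set of its atoms.
  On vectors, \<open>+\<close>, \<open>-\<close>, \<open>*\<close>, \<open>\<le>\<close>, \<open>0\<close> and \<open>1\<close> are the componentwise library instances, so \<open>*\<close> is
  the entrywise product and \<open>1 :: real ^ 'n\<close> is the vector of ones; the product of matrices is \<open>**\<close>
  and the identity matrix is \<open>mat 1\<close>.
\<close>

definition strictly_coarser :: "'n set set \<Rightarrow> 'n set set \<Rightarrow> bool" (infix "\<prec>\<^sub>P" 50)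
  where "R \<prec>\<^sub>P Q \<longleftrightarrow> R \<noteq> Q \<and> refines UNIV Q R"

definition filtration :: "nat \<Rightarrow> (nat \<Rightarrow> 'n set set) \<Rightarrow> bool"
  where "filtration k R \<longleftrightarrow>
    (\<forall>s\<le>k. partition_on UNIV (R s)) \<and> (\<forall>s<k. R s \<prec>\<^sub>P R (Suc s))"

definition part_mat :: "'n set set \<Rightarrow> real ^ 'n::finite ^ 'n"
  where "part_mat R = (\<chi> i j. if \<exists>A\<in>R. i \<in> A \<and> j \<in> A then 1 else 0)"

definition meas_vec :: "'n set set \<Rightarrow> real ^ 'n::finite \<Rightarrow> bool"
  where "meas_vec R v \<longleftrightarrow> (\<forall>A\<in>R. \<forall>i\<in>A. \<forall>j\<in>A. v $ i = v $ j)"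

definition meas_partition :: "'n set set \<Rightarrow> real ^ 'n::finite \<Rightarrow> real ^ 'n \<Rightarrow> bool"
  where "meas_partition R p q \<longleftrightarrow>
    (\<forall>i. p $ i \<in> {0, 1}) \<and> (\<forall>i. q $ i \<in> {0, 1}) \<and>
    meas_vec R p \<and> meas_vec R q \<and> p * q = 0 \<and> p + q = 1"

definition diag_mat :: "real ^ 'n::finite \<Rightarrow> real ^ 'n ^ 'n"
  where "diag_mat v = (\<chi> i j. if i = j then v $ i else 0)"

definition cond_exp_mat :: "'n set set \<Rightarrow> real ^ 'n::finite ^ 'n"
  where "cond_exp_mat R = matrix_inv (diag_mat (part_mat R *v 1)) ** part_mat R"

text \<open>
  Vectors which may have infinite components take values in \<^typ>\<open>ereal\<close>, where \<open>1 / \<infinity> = 0\<close>,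
  \<open>1 / 0 = \<infinity>\<close> and \<open>0 * \<infinity> = 0\<close>. As \<open>*v\<close> requires a semiring, which \<^typ>\<open>ereal\<close> is not, the action
  of the conditional expectation on such vectors is written out.
\<close>

definition ereal_vec :: "real ^ 'n \<Rightarrow> ereal ^ 'n"
  where "ereal_vec v = (\<chi> i. ereal (v $ i))"

definition vec_quot :: "ereal ^ 'n \<Rightarrow> ereal ^ 'n \<Rightarrow> ereal ^ 'n"
  where "vec_quot u v = (\<chi> i. u $ i / v $ i)"

definition cond_exp_ereal :: "'n set set \<Rightarrow> ereal ^ 'n::finite \<Rightarrow> ereal ^ 'n"
  where "cond_exp_ereal R v = (\<chi> i. \<Sum>j\<in>UNIV. ereal (cond_exp_mat R $ i $ j) * v $ j)"

definition bi_potential :: "real ^ 'n::finite ^ 'n \<Rightarrow> bool"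
  where "bi_potential V \<longleftrightarrow>
    (\<forall>i j. V $ i $ j \<ge> 0) \<and> invertible V \<and>
    (\<forall>i j. i \<noteq> j \<longrightarrow> matrix_inv V $ i $ j \<le> 0) \<and>
    (\<forall>i. matrix_inv V $ i $ i > 0) \<and>
    (\<forall>i. (\<Sum>j\<in>UNIV. matrix_inv V $ i $ j) \<ge> 0) \<and>
    (\<forall>j. (\<Sum>i\<in>UNIV. matrix_inv V $ i $ j) \<ge> 0)"

end

theory Submission
  imports Defs
begin

text \<open>
  Let \<open>V\<^bsub>s\<^esub>\<close> be \<open>I\<close> plus the summands of \<open>U\<close> with index at least \<open>s\<close>; it is block diagonal with
  respect to the atoms of \<open>R s\<close>. Passing from \<open>V\<^bsub>s+1\<^esub>\<close> to \<open>V\<^bsub>s\<^esub>\<close> is, on every atom, two rank-one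
  updates, so the Sherman--Morrison formula keeps the off-diagonal entries of the inverse nonpositive,
  and it keeps the row and column sums nonnegative as long as \<open>\<gamma>\<^bsub>s\<^esub> E\<^bsub>s\<^esub>(p\<^bsub>s\<^esub> / x) \<le> 1\<close> and
  \<open>\<gamma>\<^bsub>s\<^esub> E\<^bsub>s\<^esub>(q\<^bsub>s\<^esub> / x) \<le> 1\<close> for \<open>x = c\<^bsub>s+1\<^esub> + d\<^bsub>s+1\<^esub>\<close>: the total mass of the inverse of \<open>V\<^bsub>s\<^esub>\<close> over
  an atom, divided by the size of the atom, is \<open>1 / (c\<^bsub>s\<^esub> + d\<^bsub>s\<^esub>)\<close>. These two inequalities follow from
  \<open>\<rho>\<^bsub>s\<^esub> \<gamma>\<^bsub>s\<^esub> \<le> x\<close>, which holds because \<open>d\<^bsub>s\<^esub>\<close>, being at least a harmonic mean of \<open>x\<close>, inherits every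
  constant lower bound of \<open>c\<^bsub>s+1\<^esub> + \<dots> + c\<^bsub>k\<^esub>\<close> on an atom. In particular all \<open>d\<^bsub>s\<^esub>\<close> are finite. The
  argument is invariant under scaling \<open>U\<close> by \<open>t\<close>, and \<open>U\<^sup>-\<^sup>1\<close> is the limit of \<open>t (I + t U)\<^sup>-\<^sup>1\<close>.
\<close>

subsection \<open>Atoms and conditional expectations\<close>

text \<open>As a union of blocks this involves no choice of a block, is symmetric in its two indices
  for any family \<open>R\<close>, and matches the entry condition of
  \<open>part_mat\<close>.\<close>

definition atom_of :: "'n set set \<Rightarrow> 'n \<Rightarrow> 'n set"
  where "atom_of R i = {j. \<exists>A\<in>R. i \<in> A \<and> j \<in> A}"

definition const_on_atoms :: "'n set set \<Rightarrow> ('n \<Rightarrow> 'a) \<Rightarrow> bool"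
  where "const_on_atoms R f \<longleftrightarrow> (\<forall>i. \<forall>j\<in>atom_of R i. f j = f i)"

lemma const_on_atomsD: "const_on_atoms R f \<Longrightarrow> j \<in> atom_of R i \<Longrightarrow> f j = f i"
  by (auto simp: const_on_atoms_def)

lemma const_on_atomsI: "(\<And>i j. j \<in> atom_of R i \<Longrightarrow> f j = f i) \<Longrightarrow> const_on_atoms R f"
  by (auto simp: const_on_atoms_def)

lemma atom_of_self: "partition_on UNIV R \<Longrightarrow> i \<in> atom_of R i"
  by (auto simp: atom_of_def partition_on_def)

lemma atom_of_eq:
  assumes "partition_on UNIV R" "j \<in> atom_of R i"
  shows "atom_of R j = atom_of R i"
proof -
  obtain A where A: "A \<in> R" "i \<in> A" "j \<in> A"
    using assms(2) by (auto simp: atom_of_def)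
  have uniq: "B = A" if "B \<in> R" "i \<in> B \<or> j \<in> B" for B
    using that A partition_onD2[OF assms(1)] by (meson disjointD disjoint_iff)
  have "atom_of R i = A" "atom_of R j = A"
    using A by (auto simp: atom_of_def dest: uniq)
  then show ?thesis by simp
qed

lemma atom_of_sym: "j \<in> atom_of R i \<longleftrightarrow> i \<in> atom_of R j"
  by (auto simp: atom_of_def)

lemma atom_of_mono: "refines UNIV Q R \<Longrightarrow> atom_of Q i \<subseteq> atom_of R i"
  unfolding refines_def by (clarsimp simp: atom_of_def) (meson subsetD)

lemma const_on_atoms_iff_meas_vec: "const_on_atoms R (($) v) \<longleftrightarrow> meas_vec R v"
  by (auto simp: const_on_atoms_def meas_vec_def atom_of_def)

lemma part_mat_nth: "part_mat R $ i $ j = of_bool (j \<in> atom_of R i)"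
  by (auto simp: part_mat_def atom_of_def)

lemma sum_of_bool_atom:
  fixes f :: "'n::finite \<Rightarrow> real"
  shows "(\<Sum>j\<in>UNIV. of_bool (j \<in> atom_of R i) * f j) = sum f (atom_of R i)"
  by (simp add: of_bool_def if_distrib[of "\<lambda>x. x * _"] sum.If_cases cong: if_cong)

lemma part_mat_mult_vec_nth: "(part_mat R *v v) $ i = (\<Sum>j\<in>atom_of R i. v $ j)"
  by (simp add: matrix_vector_mult_def part_mat_nth sum_of_bool_atom)

lemma card_atom_of_pos:
  fixes R :: "'n::finite set set"
  shows "partition_on UNIV R \<Longrightarrow> 0 < card (atom_of R i)"
  using atom_of_self[of R i] by (auto simp: card_gt_0_iff)

lemma diag_mat_mult_nth: "(diag_mat u ** A) $ i $ j = u $ i * A $ i $ j"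
  by (simp add: diag_mat_def matrix_matrix_mult_def if_distrib[of "\<lambda>x. x * _"] cong: if_cong)

lemma mult_diag_mat_nth: "(A ** diag_mat u) $ i $ j = A $ i $ j * u $ j"
  by (simp add: diag_mat_def matrix_matrix_mult_def if_distrib[of "\<lambda>x. _ * x"] cong: if_cong)

text \<open>\<open>matrix_inv\<close> is a choice operator, so its value must be pinned down; for
  square matrices a one-sided inverse suffices.\<close>

lemma matrix_inv_eqI:
  fixes A B :: "real ^ 'n::finite ^ 'n"
  assumes "A ** B = mat 1"
  shows "matrix_inv A = B"
proof -
  have BA: "B ** A = mat 1"
    using assms matrix_left_right_inverse by blast
  have "\<exists>X. A ** X = mat 1 \<and> X ** A = mat 1"
    using assms BA by blast
  then have "A ** matrix_inv A = mat 1"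
    unfolding matrix_inv_def by (rule someI2_ex) blast
  then have "B ** (A ** matrix_inv A) = B"
    by simp
  then show ?thesis
    by (simp add: matrix_mul_assoc BA)
qed

lemma cond_exp_mat_nth:
  assumes "partition_on UNIV R"
  shows "cond_exp_mat R $ i $ j = of_bool (j \<in> atom_of R i) / card (atom_of R i)"
proof -
  have "diag_mat (part_mat R *v 1) ** diag_mat (\<chi> i. 1 / card (atom_of R i)) = mat 1"
    using card_atom_of_pos[OF assms]
    by (simp add: vec_eq_iff diag_mat_mult_nth part_mat_mult_vec_nth mat_def)
      (simp add: diag_mat_def less_imp_neq[symmetric])
  then have "matrix_inv (diag_mat (part_mat R *v 1)) = diag_mat (\<chi> i. 1 / card (atom_of R i))"
    by (rule matrix_inv_eqI)
  then show ?thesis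
    by (simp add: cond_exp_mat_def diag_mat_mult_nth part_mat_nth)
qed

lemma cond_exp_mat_mult_vec_nth:
  assumes "partition_on UNIV R"
  shows "(cond_exp_mat R *v v) $ i = (\<Sum>j\<in>atom_of R i. v $ j) / card (atom_of R i)"
  using sum_of_bool_atom[of R i "($) v"]
  by (simp add: matrix_vector_mult_def cond_exp_mat_nth[OF assms] flip: sum_divide_distrib)

text \<open>
  The conditional expectation of a refinement is self-adjoint and fixes \<open>w\<close>, so against \<open>w\<close> the
  vector \<open>l\<close> may be replaced by its expectation \<open>u\<close>.
\<close>

lemma sum_atom_cond_exp:
  fixes w l u :: "'n::finite \<Rightarrow> real"
  assumes Q: "partition_on UNIV Q" and QR: "refines UNIV Q R" and R: "partition_on UNIV R"
    and w: "const_on_atoms Q w"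
    and u: "\<And>i. sum l (atom_of Q i) = card (atom_of Q i) * u i"
  shows "(\<Sum>j\<in>atom_of R i. w j * l j) = (\<Sum>j\<in>atom_of R i. w j * u j)"
proof -
  let ?N = "\<lambda>j. real (card (atom_of Q j))"
  have sub: "atom_of Q j \<subseteq> atom_of R i" if "j \<in> atom_of R i" for j
    using atom_of_mono[OF QR, of j] atom_of_eq[OF R that] by simp
  have N: "?N j > 0" for j
    using card_atom_of_pos[OF Q] by simp
  have filt: "{m \<in> atom_of R i. m \<in> atom_of Q j} = atom_of Q j" if "j \<in> atom_of R i" for j
    using sub[OF that] by auto
  have restr: "(\<Sum>m\<in>atom_of R i. if m \<in> atom_of Q j then f m else 0) = sum f (atom_of Q j)"
    if "j \<in> atom_of R i" for j and f :: "'n \<Rightarrow> real"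
    using filt[OF that] by (simp flip: sum.inter_filter)
  have "(\<Sum>j\<in>atom_of R i. w j * u j)
      = (\<Sum>j\<in>atom_of R i. \<Sum>m\<in>atom_of R i. if m \<in> atom_of Q j then w j * l m / ?N j else 0)"
  proof (rule sum.cong[OF refl])
    fix j assume j: "j \<in> atom_of R i"
    have "w j * u j = (\<Sum>m\<in>atom_of Q j. w j * l m / ?N j)"
      using N[of j] u[of j] by (auto simp flip: sum_distrib_left sum_divide_distrib)
    then show "w j * u j = (\<Sum>m\<in>atom_of R i. if m \<in> atom_of Q j then w j * l m / ?N j else 0)"
      using restr[OF j] by simp
  qed
  also have "\<dots> = (\<Sum>m\<in>atom_of R i. \<Sum>j\<in>atom_of R i. if m \<in> atom_of Q j then w j * l m / ?N j else 0)"
    by (rule sum.swap)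
  \<comment> \<open>Lying in the same atom of \<open>Q\<close> is symmetric, and \<open>w\<close>
    and the atom size are constant there; this is the self-adjointness.\<close>
  also have "\<dots> = (\<Sum>m\<in>atom_of R i. \<Sum>j\<in>atom_of R i. if j \<in> atom_of Q m then w m * l m / ?N m else 0)"
    by (intro sum.cong refl if_cong)
      (simp_all add: atom_of_sym[of _ Q] atom_of_eq[OF Q] const_on_atomsD[OF w])
  also have "\<dots> = (\<Sum>m\<in>atom_of R i. w m * l m)"
    using N by (intro sum.cong refl) (simp add: restr less_imp_neq[symmetric])
  finally show ?thesis ..
qed

subsection \<open>Blockwise rank-one updates\<close>

text \<open>\<open>G\<close> is an explicit inverse of \<open>V\<close>, carried through the
  updates. Positivity of its diagonal is recovered in \<open>bi_potentialI\<close> from the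
  nonnegativity of \<open>V\<close>.\<close>

definition block_potential ::
    "'n::finite set set \<Rightarrow> ('n \<Rightarrow> 'n \<Rightarrow> real) \<Rightarrow> ('n \<Rightarrow> 'n \<Rightarrow> real) \<Rightarrow> bool"
  where "block_potential R V G \<longleftrightarrow>
    (\<forall>i j. j \<notin> atom_of R i \<longrightarrow> V i j = 0 \<and> G i j = 0) \<and>
    (\<forall>i j. (\<Sum>l\<in>UNIV. V i l * G l j) = of_bool (i = j)) \<and>
    (\<forall>i j. i \<noteq> j \<longrightarrow> G i j \<le> 0) \<and>
    (\<forall>i. 0 \<le> (\<Sum>j\<in>UNIV. G i j)) \<and>
    (\<forall>j. 0 \<le> (\<Sum>i\<in>UNIV. G i j))"

lemma block_potential_mono:
  "refines UNIV Q R \<Longrightarrow> block_potential Q V G \<Longrightarrow> block_potential R V G"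
  by (simp add: block_potential_def) (meson atom_of_mono subsetD)

lemma sum_if_atom:
  fixes f :: "'n::finite \<Rightarrow> real"
  shows "(\<Sum>j\<in>UNIV. if j \<in> atom_of R i then f j else 0) = sum f (atom_of R i)"
    and "(\<Sum>j\<in>UNIV. if i \<in> atom_of R j then f j else 0) = sum f (atom_of R i)"
  by (simp_all add: sum.If_cases atom_of_sym[of i R])

text \<open>
  The Sherman--Morrison formula, applied simultaneously on all atoms: the updated matrix is
  \<open>V + D\<^bsub>\<alpha>\<^esub> D\<^bsub>a\<^esub> F(R) D\<^bsub>b\<^esub>\<close>.
\<close>

lemma block_potential_rank_one:
  fixes V G :: "'n::finite \<Rightarrow> 'n \<Rightarrow> real"
  assumes R: "partition_on UNIV R" and VG: "block_potential R V G"
    and \<alpha>: "const_on_atoms R \<alpha>" "\<And>i. 0 \<le> \<alpha> i"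
    and g: "\<And>i. g i = (\<Sum>l\<in>UNIV. G i l * a l)" "\<And>i. 0 \<le> g i"
    and h: "\<And>j. h j = (\<Sum>l\<in>UNIV. b l * G l j)" "\<And>j. 0 \<le> h j"
    and b: "\<And>i. 0 \<le> b i"
    and \<beta>: "\<And>i. \<beta> i = \<alpha> i / (1 + \<alpha> i * (\<Sum>l\<in>atom_of R i. b l * g l))"
    and row: "\<And>i. \<beta> i * g i * sum h (atom_of R i) \<le> (\<Sum>j\<in>UNIV. G i j)"
    and col: "\<And>j. \<beta> j * h j * sum g (atom_of R j) \<le> (\<Sum>i\<in>UNIV. G i j)"
  shows "block_potential R
    (\<lambda>i j. V i j + (if j \<in> atom_of R i then \<alpha> i * a i * b j else 0))
    (\<lambda>i j. G i j - (if j \<in> atom_of R i then \<beta> i * g i * h j else 0))"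
    (is "block_potential R ?V ?G")
proof -
  define \<sigma> where "\<sigma> i = (\<Sum>l\<in>atom_of R i. b l * g l)" for i
  have V0: "V i j = 0" and G0: "G i j = 0" if "j \<notin> atom_of R i" for i j
    using VG that by (auto simp: block_potential_def)
  have inv: "(\<Sum>l\<in>UNIV. V i l * G l j) = of_bool (i = j)" for i j
    using VG by (auto simp: block_potential_def)
  have \<sigma>_nonneg: "0 \<le> \<sigma> i" for i
    unfolding \<sigma>_def using b g(2) by (intro sum_nonneg mult_nonneg_nonneg)
  have pos: "0 < 1 + \<alpha> i * \<sigma> i" for i
    using \<sigma>_nonneg \<alpha>(2) by (simp add: add_pos_nonneg)
  have \<beta>_nonneg: "0 \<le> \<beta> i" for i
    using \<alpha>(2) pos[of i] by (simp add: \<beta> flip: \<sigma>_def)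
  have \<beta>_const: "\<beta> j = \<beta> i" if "j \<in> atom_of R i" for i j
    using const_on_atomsD[OF \<alpha>(1) that] atom_of_eq[OF R that] by (simp add: \<beta>)
  \<comment> \<open>\<open>g\<close> is \<open>G\<close> applied to \<open>a\<close>, so
    \<open>V\<close> sends it back to \<open>a\<close>.\<close>
  have Vg: "(\<Sum>l\<in>UNIV. V i l * g l) = a i" for i
  proof -
    have "(\<Sum>l\<in>UNIV. V i l * g l) = (\<Sum>l\<in>UNIV. \<Sum>m\<in>UNIV. V i l * G l m * a m)"
      by (simp add: g(1) sum_distrib_left mult.assoc)
    also have "\<dots> = (\<Sum>m\<in>UNIV. (\<Sum>l\<in>UNIV. V i l * G l m) * a m)"
      unfolding sum_distrib_right by (rule sum.swap)
    also have "\<dots> = a i"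
      by (simp add: inv)
    finally show ?thesis .
  qed
  have to_atom: "(\<Sum>l\<in>UNIV. f l) = sum f (atom_of R i)" if "\<And>l. l \<notin> atom_of R i \<Longrightarrow> f l = 0"
    for i and f :: "'n \<Rightarrow> real"
    by (intro sum.mono_neutral_right) (auto simp: that)
  have "(\<Sum>l\<in>UNIV. ?V i l * ?G l j) = of_bool (i = j)" for i j
  proof (cases "j \<in> atom_of R i")
    case True
    note j = atom_of_eq[OF R True]
    have "(\<Sum>l\<in>UNIV. ?V i l * ?G l j) = (\<Sum>l\<in>atom_of R i. ?V i l * ?G l j)"
      by (intro to_atom) (simp add: V0)
    \<comment> \<open>\<open>\<beta>\<close> is constant on the atom, so the product splits into
      four terms, whose sums involve the identity, \<open>a i\<close>, \<open>h j\<close> and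
      \<open>\<sigma> i\<close>.\<close>
    also have "\<dots> = (\<Sum>l\<in>atom_of R i. V i l * G l j - \<beta> i * h j * (V i l * g l)
        + \<alpha> i * a i * (b l * G l j) - \<alpha> i * a i * \<beta> i * h j * (b l * g l))"
    proof (intro sum.cong refl)
      fix l assume l: "l \<in> atom_of R i"
      have "j \<in> atom_of R l"
        using atom_of_eq[OF R l] True by simp
      with l \<beta>_const[OF l] show "?V i l * ?G l j = V i l * G l j - \<beta> i * h j * (V i l * g l)
        + \<alpha> i * a i * (b l * G l j) - \<alpha> i * a i * \<beta> i * h j * (b l * g l)"
        by (simp add: algebra_simps)
    qed
    also have "\<dots> = (\<Sum>l\<in>atom_of R i. V i l * G l j) - \<beta> i * h j * (\<Sum>l\<in>atom_of R i. V i l * g l)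
        + \<alpha> i * a i * (\<Sum>l\<in>atom_of R i. b l * G l j) - \<alpha> i * a i * \<beta> i * h j * \<sigma> i"
      by (simp add: sum.distrib sum_subtractf sum_distrib_left \<sigma>_def)
    also have "(\<Sum>l\<in>atom_of R i. V i l * G l j) = of_bool (i = j)"
      using inv[of i j] to_atom[of i "\<lambda>l. V i l * G l j"] by (simp add: V0)
    also have "(\<Sum>l\<in>atom_of R i. V i l * g l) = a i"
      using Vg[of i] to_atom[of i "\<lambda>l. V i l * g l"] by (simp add: V0)
    also have "(\<Sum>l\<in>atom_of R i. b l * G l j) = h j"
      using to_atom[of i "\<lambda>l. b l * G l j"] j by (simp add: h(1) G0 atom_of_sym[of j])
    finally have "(\<Sum>l\<in>UNIV. ?V i l * ?G l j)
        = of_bool (i = j) + a i * h j * (\<alpha> i - \<beta> i * (1 + \<alpha> i * \<sigma> i))"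
      by (simp add: algebra_simps)
    \<comment> \<open>\<open>\<beta>\<close> is chosen to make this coefficient vanish.\<close>
    also have "\<alpha> i - \<beta> i * (1 + \<alpha> i * \<sigma> i) = 0"
      using pos[of i] by (simp add: \<beta> flip: \<sigma>_def)
    finally show ?thesis by simp
  next
    case False
    have "?V i l * ?G l j = 0" for l
    proof (cases "l \<in> atom_of R i")
      case True
      then have "j \<notin> atom_of R l"
        using False atom_of_eq[OF R True] by simp
      then show ?thesis by (simp add: G0)
    qed (simp add: V0)
    moreover have "i \<noteq> j"
      using False atom_of_self[OF R] by auto
    ultimately show ?thesis
      using sum.neutral[of UNIV "\<lambda>l. ?V i l * ?G l j"] by simp
  qed
  moreover have "?G i j \<le> 0" if "i \<noteq> j" for i j
  proof -
    have "G i j \<le> 0"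
      using VG that by (auto simp: block_potential_def)
    moreover have "0 \<le> \<beta> i * g i * h j"
      using \<beta>_nonneg g(2) h(2) by simp
    ultimately show ?thesis by auto
  qed
  moreover have "0 \<le> (\<Sum>j\<in>UNIV. ?G i j)" for i
    using row[of i] by (simp add: sum_subtractf sum_if_atom sum_distrib_left)
  moreover have "0 \<le> (\<Sum>i\<in>UNIV. ?G i j)" for j
  proof -
    have "(\<Sum>i\<in>UNIV. if j \<in> atom_of R i then \<beta> i * g i * h j else 0)
        = (\<Sum>i\<in>atom_of R j. \<beta> j * h j * g i)"
      unfolding sum_if_atom by (intro sum.cong refl) (simp add: \<beta>_const)
    then show ?thesis
      using col[of j] by (simp add: sum_subtractf sum_distrib_left)
  qed
  ultimately show ?thesis
    by (auto simp: block_potential_def V0 G0)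
qed

text \<open>\<open>G\<close> vanishes between different atoms, so both sides are the total of its
  entries over one diagonal block.\<close>

lemma sum_atom_margins:
  assumes R: "partition_on UNIV R" and VG: "block_potential R V G"
  shows "(\<Sum>i\<in>atom_of R m. \<Sum>j\<in>UNIV. G i j) = (\<Sum>j\<in>atom_of R m. \<Sum>i\<in>UNIV. G i j)"
proof -
  have G0: "G i j = 0" if "j \<notin> atom_of R i" for i j
    using VG that by (auto simp: block_potential_def)
  have "(\<Sum>j\<in>UNIV. G i j) = (\<Sum>j\<in>atom_of R m. G i j)" if "i \<in> atom_of R m" for i
    using atom_of_eq[OF R that] G0[of _ i] by (intro sum.mono_neutral_right) auto
  moreover have "(\<Sum>i\<in>UNIV. G i j) = (\<Sum>i\<in>atom_of R m. G i j)" if "j \<in> atom_of R m" for j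
    using atom_of_eq[OF R that] G0[of j] atom_of_sym[of j R]
    by (intro sum.mono_neutral_right) auto
  ultimately show ?thesis
    by (simp add: sum.swap[of G])
qed

text \<open>
  Two updates: first by \<open>D\<^bsub>\<Gamma>\<^esub> D\<^bsub>a\<^esub> F(R) D\<^bsub>b\<^esub>\<close>, where the Sherman--Morrison denominator is \<open>1\<close> because
  \<open>G\<close> does not connect \<open>a\<close> to \<open>b\<close>, then by \<open>D\<^bsub>C\<^esub> F(R)\<close>.
\<close>

lemma block_potential_step:
  fixes V G :: "'n::finite \<Rightarrow> 'n \<Rightarrow> real" and u a b C \<Gamma> :: "'n \<Rightarrow> real"
  assumes Q: "partition_on UNIV Q" and R: "partition_on UNIV R" and QR: "refines UNIV Q R"
    and VG: "block_potential Q V G"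
    and u: "\<And>i. (\<Sum>j\<in>atom_of Q i. \<Sum>l\<in>UNIV. G j l) = card (atom_of Q i) * u i"
    and ab: "\<And>i. a i = 0 \<and> b i = 1 \<or> a i = 1 \<and> b i = 0"
    and ab_const: "const_on_atoms Q a" "const_on_atoms Q b"
    and C: "const_on_atoms R C" "\<And>i. 0 \<le> C i"
    and \<Gamma>: "const_on_atoms R \<Gamma>" "\<And>i. 0 \<le> \<Gamma> i"
    and small: "\<And>i. \<Gamma> i * (\<Sum>j\<in>atom_of R i. a j * u j) \<le> 1"
      "\<And>i. \<Gamma> i * (\<Sum>j\<in>atom_of R i. b j * u j) \<le> 1"
    and M: "\<And>i. M i = (\<Sum>j\<in>atom_of R i. u j)
      - \<Gamma> i * (\<Sum>j\<in>atom_of R i. a j * u j) * (\<Sum>j\<in>atom_of R i. b j * u j)"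
  shows "\<exists>G'. block_potential R
      (\<lambda>i j. V i j + (if j \<in> atom_of R i then C i + \<Gamma> i * a i * b j else 0)) G' \<and>
    (\<forall>i. (\<Sum>j\<in>atom_of R i. \<Sum>l\<in>UNIV. G' j l) = M i / (1 + C i * M i))"
proof -
  define row where "row i = (\<Sum>j\<in>UNIV. G i j)" for i
  define col where "col j = (\<Sum>i\<in>UNIV. G i j)" for j
  have VG_R: "block_potential R V G"
    using QR VG by (rule block_potential_mono)
  have G0: "G i j = 0" if "j \<notin> atom_of Q i" for i j
    using VG that by (auto simp: block_potential_def)
  have row_nonneg: "0 \<le> row i" and col_nonneg: "0 \<le> col i" for i
    using VG by (auto simp: block_potential_def row_def col_def)
  have ab_nonneg: "0 \<le> a i" "0 \<le> b i" for i
    using ab[of i] by auto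
  have u_row: "sum row (atom_of Q i) = card (atom_of Q i) * u i" for i
    using u by (simp add: row_def)
  \<comment> \<open>Row and column sums have the same averages \<open>u\<close> on atoms of
    \<open>Q\<close>, so both may be replaced by \<open>u\<close> against
    \<open>Q\<close>-measurable weights.\<close>
  have u_col: "sum col (atom_of Q i) = card (atom_of Q i) * u i" for i
    using u_row sum_atom_margins[OF Q VG, of i] by (simp add: row_def col_def)
  note swap = sum_atom_cond_exp[OF Q QR R]
  define A where "A i = (\<Sum>j\<in>atom_of R i. a j * u j)" for i
  define B where "B i = (\<Sum>j\<in>atom_of R i. b j * u j)" for i
  have A: "(\<Sum>j\<in>atom_of R i. a j * row j) = A i" for i
    unfolding A_def using ab_const(1) u_row by (rule swap)
  have B: "(\<Sum>j\<in>atom_of R i. b j * col j) = B i" for i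
    unfolding B_def using ab_const(2) u_col by (rule swap)
  have A_nonneg: "0 \<le> A i" and B_nonneg: "0 \<le> B i" for i
    using ab_nonneg row_nonneg col_nonneg by (auto intro!: sum_nonneg simp flip: A B)
  have const: "\<Gamma> j = \<Gamma> i" "A j = A i" "B j = B i" "C j = C i" if "j \<in> atom_of R i" for i j
    using const_on_atomsD[OF \<Gamma>(1) that] const_on_atomsD[OF C(1) that] atom_of_eq[OF R that]
    by (simp_all add: A_def B_def)
  \<comment> \<open>\<open>M\<close> is the atom mass after the first update, here split by
    \<open>a + b = 1\<close>.\<close>
  have M_eq: "M i = A i + B i - \<Gamma> i * A i * B i" for i
  proof -
    have "u j = a j * u j + b j * u j" for j
      using ab[of j] by auto
    then have "sum u (atom_of R i) = A i + B i"
      unfolding A_def B_def by (simp flip: sum.distrib)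
    then show ?thesis by (simp add: M A_def B_def)
  qed
  have \<Gamma>A: "\<Gamma> i * A i \<le> 1" and \<Gamma>B: "\<Gamma> i * B i \<le> 1" for i
    using small by (simp_all add: A_def B_def)
  have M_nonneg: "0 \<le> M i" for i
    using mult_right_mono[OF \<Gamma>A B_nonneg, of i i] A_nonneg[of i] by (simp add: M_eq)
  have M_const: "M j = M i" if "j \<in> atom_of R i" for i j
    using const[OF that] by (simp add: M_eq)

  let ?V = "\<lambda>i j. V i j + (if j \<in> atom_of R i then \<Gamma> i * a i * b j else 0)"
  define H where "H i j = G i j - (if j \<in> atom_of R i then \<Gamma> i * (a i * row i) * (b j * col j) else 0)"
    for i j
  have VH: "block_potential R ?V H"
    unfolding H_def
  proof (rule block_potential_rank_one[OF R VG_R \<Gamma>])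
    \<comment> \<open>\<open>a\<close> is constant on atoms of \<open>Q\<close> and \<open>G\<close>
      vanishes across them, so applying \<open>G\<close> to \<open>a\<close> multiplies the row sums
      by \<open>a\<close>; likewise for \<open>b\<close> and columns.\<close>
    show "a i * row i = (\<Sum>l\<in>UNIV. G i l * a l)" for i
    proof -
      have "G i l * a l = a i * G i l" for l
        using G0[of l i] const_on_atomsD[OF ab_const(1), of l i] by (cases "l \<in> atom_of Q i") auto
      then show ?thesis by (simp only: row_def sum_distrib_left)
    qed
    show "b j * col j = (\<Sum>l\<in>UNIV. b l * G l j)" for j
    proof -
      have "b l * G l j = b j * G l j" for l
        using G0[of j l] const_on_atomsD[OF ab_const(2), of j l] by (cases "j \<in> atom_of Q l") auto
      then show ?thesis by (simp only: col_def sum_distrib_left)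
    qed
    show "\<Gamma> i = \<Gamma> i / (1 + \<Gamma> i * (\<Sum>l\<in>atom_of R i. b l * (a l * row l)))" for i
    proof -
      have "b l * (a l * row l) = 0" for l
        using ab[of l] by auto
      then show ?thesis by (simp only: sum.neutral_const) simp
    qed
    \<comment> \<open>Only rows with \<open>a i = 1\<close> change their sum, by the factor
      \<open>1 - \<Gamma> i * B i\<close>, which is nonnegative.\<close>
    show "\<Gamma> i * (a i * row i) * (\<Sum>j\<in>atom_of R i. b j * col j) \<le> (\<Sum>j\<in>UNIV. G i j)" for i
      using ab[of i] mult_right_mono[OF \<Gamma>B row_nonneg, of i i] row_nonneg[of i]
      by (auto simp: B row_def[symmetric] mult_ac)
    show "\<Gamma> j * (b j * col j) * (\<Sum>i\<in>atom_of R j. a i * row i) \<le> (\<Sum>i\<in>UNIV. G i j)" for j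
      using ab[of j] mult_right_mono[OF \<Gamma>A col_nonneg, of j j] col_nonneg[of j]
      by (auto simp: A col_def[symmetric] mult_ac)
  qed (simp_all add: ab_nonneg row_nonneg col_nonneg)

  define row' where "row' i = (\<Sum>j\<in>UNIV. H i j)" for i
  define col' where "col' j = (\<Sum>i\<in>UNIV. H i j)" for j
  have row'_nonneg: "0 \<le> row' i" and col'_nonneg: "0 \<le> col' i" for i
    using VH by (auto simp: block_potential_def row'_def col'_def)
  have row'_eq: "row' i = row i - \<Gamma> i * (a i * row i) * B i" for i
    by (simp add: row'_def H_def sum_subtractf sum_if_atom row_def[symmetric] B flip: sum_distrib_left)
  have row'_sum: "sum row' (atom_of R i) = M i" for i
  proof -
    have "sum row' (atom_of R i) = (\<Sum>j\<in>atom_of R i. row j - \<Gamma> i * B i * (a j * row j))"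
      by (intro sum.cong refl) (simp add: row'_eq const mult_ac)
    also have "\<dots> = sum row (atom_of R i) - \<Gamma> i * B i * A i"
      by (simp add: sum_subtractf A flip: sum_distrib_left)
    also have "sum row (atom_of R i) = sum u (atom_of R i)"
      using swap[of "\<lambda>_. 1" row u i] u_row by (simp add: const_on_atoms_def)
    finally show ?thesis
      by (simp add: M A_def B_def mult_ac)
  qed
  have col'_sum: "sum col' (atom_of R i) = M i" for i
    using row'_sum sum_atom_margins[OF R VH, of i] by (simp add: row'_def col'_def)
  define \<beta> where "\<beta> i = C i / (1 + C i * M i)" for i
  have pos: "0 < 1 + C i * M i" for i
    using C(2)[of i] M_nonneg[of i] by (simp add: add_pos_nonneg)
  have \<beta>M: "\<beta> i * M i \<le> 1" for i
    using pos[of i] by (simp add: \<beta>_def divide_le_eq_1)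
  define K where "K i j = H i j - (if j \<in> atom_of R i then \<beta> i * row' i * col' j else 0)" for i j
  \<comment> \<open>In the second update \<open>a = b = 1\<close>, so its vectors are the row and
    column sums of \<open>H\<close>, both of total \<open>M\<close> on the atom.\<close>
  have "block_potential R
      (\<lambda>i j. ?V i j + (if j \<in> atom_of R i then C i * (\<lambda>_. 1) i * (\<lambda>_. 1) j else 0)) K"
    unfolding K_def
  proof (rule block_potential_rank_one[OF R VH C])
    show "\<beta> i * row' i * sum col' (atom_of R i) \<le> (\<Sum>j\<in>UNIV. H i j)" for i
      using mult_right_mono[OF \<beta>M row'_nonneg, of i i]
      by (simp add: col'_sum row'_def[symmetric] mult_ac)
    show "\<beta> j * col' j * sum row' (atom_of R j) \<le> (\<Sum>i\<in>UNIV. H i j)" for j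
      using mult_right_mono[OF \<beta>M col'_nonneg, of j j]
      by (simp add: row'_sum col'_def[symmetric] mult_ac)
    show "\<beta> i = C i / (1 + C i * (\<Sum>l\<in>atom_of R i. 1 * row' l))" for i
      by (simp add: \<beta>_def row'_sum)
  qed (simp_all add: row'_nonneg col'_nonneg row'_def[symmetric] col'_def[symmetric])
  moreover have "(\<lambda>i j. ?V i j + (if j \<in> atom_of R i then C i * (\<lambda>_. 1) i * (\<lambda>_. 1) j else 0))
      = (\<lambda>i j. V i j + (if j \<in> atom_of R i then C i + \<Gamma> i * a i * b j else 0))"
    by (auto simp: fun_eq_iff)
  moreover have "(\<Sum>j\<in>atom_of R i. \<Sum>l\<in>UNIV. K j l) = M i / (1 + C i * M i)" for i
  proof -
    have "(\<Sum>l\<in>UNIV. K j l) = row' j - \<beta> j * row' j * M j" for j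
      by (simp add: K_def sum_subtractf sum_if_atom row'_def[symmetric] col'_sum
          flip: sum_distrib_left)
    then have "(\<Sum>j\<in>atom_of R i. \<Sum>l\<in>UNIV. K j l)
        = (\<Sum>j\<in>atom_of R i. row' j - \<beta> i * M i * row' j)"
      by (simp add: \<beta>_def const M_const mult_ac cong: sum.cong)
    also have "\<dots> = M i - \<beta> i * M i * M i"
      by (simp add: sum_subtractf row'_sum flip: sum_distrib_left)
    also have "\<dots> = M i / (1 + C i * M i)"
      using pos[of i] by (simp add: \<beta>_def field_simps)
    finally show ?thesis .
  qed
  ultimately show ?thesis
    by auto
qed

subsection \<open>The backward recursion\<close>

text \<open>Each index of weight 1 contributes at most \<open>1 / sum w S\<close>, and there are
  \<open>sum w S\<close> of them. With \<open>w\<close> equal to \<open>p s\<close> or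
  \<open>q s\<close> this yields the two smallness conditions.\<close>

lemma mult_sum_div_le_1:
  fixes w x :: "'a \<Rightarrow> real"
  assumes S: "finite S" and w: "\<And>j. j \<in> S \<Longrightarrow> w j = 0 \<or> w j = 1"
    and x: "\<And>j. j \<in> S \<Longrightarrow> 0 < x j"
    and le: "\<And>j. j \<in> S \<Longrightarrow> w j = 1 \<Longrightarrow> g * sum w S \<le> x j"
  shows "g * (\<Sum>j\<in>S. w j * (1 / x j)) \<le> 1"
proof (cases "sum w S = 0")
  case True
  have "w j = 0" if "j \<in> S" for j
    using sum_nonneg_0[OF S _ True that] w by fastforce
  then show ?thesis by simp
next
  case False
  have w_nonneg: "0 \<le> w j" if "j \<in> S" for j
    using w[OF that] by auto
  then have pos: "0 < sum w S"
    using False sum_nonneg[of S w] by fastforce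
  have "g * (w j * (1 / x j)) \<le> w j / sum w S" if "j \<in> S" for j
    using w[OF that] x[OF that] le[OF that] pos by (auto simp: field_simps)
  then have "g * (\<Sum>j\<in>S. w j * (1 / x j)) \<le> (\<Sum>j\<in>S. w j / sum w S)"
    unfolding sum_distrib_left by (intro sum_mono)
  also have "\<dots> = 1"
    using False by (simp flip: sum_divide_distrib)
  finally show ?thesis .
qed

text \<open>Keeping \<open>C\<close> and \<open>\<Gamma>\<close> as parameters allows rescaling them
  by \<open>t\<close>. In \<open>bound\<close> the atom size has cancelled between \<gamma> and the
  averages in \<rho>.\<close>

locale filtered_matrix =
  fixes k :: nat and R :: "nat \<Rightarrow> 'n::finite set set" and C \<Gamma> p q :: "nat \<Rightarrow> 'n \<Rightarrow> real"
  assumes partition: "s \<le> k \<Longrightarrow> partition_on UNIV (R s)"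
    and refining: "s < k \<Longrightarrow> refines UNIV (R (Suc s)) (R s)"
    and singletons: "R k = range (\<lambda>i. {i})"
    and C_const: "s \<le> k \<Longrightarrow> const_on_atoms (R s) (C s)"
    and C_nonneg: "s \<le> k \<Longrightarrow> 0 \<le> C s i"
    and \<Gamma>_const: "s < k \<Longrightarrow> const_on_atoms (R s) (\<Gamma> s)"
    and \<Gamma>_nonneg: "s < k \<Longrightarrow> 0 \<le> \<Gamma> s i"
    and \<Gamma>_last: "\<Gamma> k i = 0"
    and pq: "s < k \<Longrightarrow> p s i = 0 \<and> q s i = 1 \<or> p s i = 1 \<and> q s i = 0"
    and p_const: "s < k \<Longrightarrow> const_on_atoms (R (Suc s)) (p s)"
    and q_const: "s < k \<Longrightarrow> const_on_atoms (R (Suc s)) (q s)"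
    and bound: "s < k \<Longrightarrow>
      \<Gamma> s i * (p s i * sum (p s) (atom_of (R s) i) + q s i * sum (q s) (atom_of (R s) i))
        \<le> (\<Sum>r=Suc s..k. C r i * card (atom_of (R r) i))"
begin

abbreviation atm :: "nat \<Rightarrow> 'n \<Rightarrow> 'n set"
  where "atm s \<equiv> atom_of (R s)"

definition c :: "nat \<Rightarrow> 'n \<Rightarrow> real"
  where "c s i = C s i * card (atm s i)"

text \<open>For \<open>u = 1 / (c + d)\<close> at level \<open>s + 1\<close>, this divided by the
  atom size is the right-hand side of the recursion for \<open>1 / d\<close>; it is also the atom
  mass of the inverse before \<open>C s\<close> enters.\<close>

definition mass :: "nat \<Rightarrow> ('n \<Rightarrow> real) \<Rightarrow> 'n \<Rightarrow> real"
  where "mass s u i = sum u (atm s i)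
    - \<Gamma> s i * (\<Sum>j\<in>atm s i. p s j * u j) * (\<Sum>j\<in>atm s i. q s j * u j)"

text \<open>The recursion runs on the distance \<open>m\<close> from level \<open>k\<close>, and
  \<open>rev_d m\<close> stands for level \<open>k - m\<close>. Only \<open>m \<le> k\<close> is
  reached from \<open>d\<close>, so the subtraction never truncates.\<close>

primrec rev_d :: "nat \<Rightarrow> 'n \<Rightarrow> real" where
  "rev_d 0 = (\<lambda>_. 1)"
| "rev_d (Suc m) = (\<lambda>i. card (atm (k - Suc m) i)
    / mass (k - Suc m) (\<lambda>j. 1 / (c (k - m) j + rev_d m j)) i)"

definition d :: "nat \<Rightarrow> 'n \<Rightarrow> real"
  where "d s = rev_d (k - s)"

abbreviation u :: "nat \<Rightarrow> 'n \<Rightarrow> real"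
  where "u s \<equiv> \<lambda>i. 1 / (c s i + d s i)"

lemma d_last: "d k i = 1"
  by (simp add: d_def)

lemma d_step:
  assumes "s < k"
  shows "d s i = card (atm s i) / mass s (u (Suc s)) i"
proof -
  have "k - s = Suc (k - Suc s)"
    using assms by simp
  then show ?thesis
    using assms by (simp add: d_def)
qed

lemma atm_last: "atm k i = {i}"
  by (auto simp: atom_of_def singletons)

lemma c_const: "s \<le> k \<Longrightarrow> const_on_atoms (R s) (c s)"
  by (rule const_on_atomsI)
    (simp add: c_def const_on_atomsD[OF C_const[of s]] atom_of_eq[OF partition[of s]])

lemma c_nonneg: "s \<le> k \<Longrightarrow> 0 \<le> c s i"
  by (simp add: c_def C_nonneg)

lemma card_atm_pos: "s \<le> k \<Longrightarrow> 0 < card (atm s i)"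
  by (rule card_atom_of_pos[OF partition])

lemma mass_const: "s < k \<Longrightarrow> const_on_atoms (R s) (mass s v)"
  by (rule const_on_atomsI)
    (simp add: mass_def const_on_atomsD[OF \<Gamma>_const[of s]] atom_of_eq[OF partition[of s]])

text \<open>
  The sum of the \<open>c r\<close> is not \<open>R s\<close>-measurable and so is not itself a lower bound of \<open>d s\<close>; only its
  constant lower bounds on atoms pass through the harmonic mean.
\<close>

definition good :: "nat \<Rightarrow> bool"
  where "good s \<longleftrightarrow> const_on_atoms (R s) (d s) \<and> (\<forall>i. 0 < d s i) \<and>
    (\<forall>i K. (\<forall>j\<in>atm s i. K \<le> (\<Sum>r=Suc s..k. c r j)) \<longrightarrow> K \<le> d s i)"

text \<open>On an atom of level \<open>s + 1\<close> the left side \<open>?L\<close> and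
  \<open>c (Suc s)\<close> are constant, so their difference is a constant lower bound of the
  remaining sum, which \<open>good\<close> passes on to \<open>d (Suc s)\<close>.\<close>

lemma good_step_bounds:
  assumes s: "s < k" and good: "good (Suc s)"
  shows "0 < c (Suc s) i + d (Suc s) i"
    and "\<Gamma> s i * (p s i * sum (p s) (atm s i) + q s i * sum (q s) (atm s i))
      \<le> c (Suc s) i + d (Suc s) i" (is "?L i \<le> _")
    and "\<Gamma> s i * (\<Sum>j\<in>atm s i. p s j * u (Suc s) j) \<le> 1"
    and "\<Gamma> s i * (\<Sum>j\<in>atm s i. q s j * u (Suc s) j) \<le> 1"
proof -
  have s': "Suc s \<le> k" and s'': "s \<le> k"
    using s by auto
  have pos: "0 < c (Suc s) j + d (Suc s) j" for j
    using good c_nonneg[OF s', of j] by (simp add: good_def add_nonneg_pos)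
  then show "0 < c (Suc s) i + d (Suc s) i" .
  have le: "?L i \<le> c (Suc s) i + d (Suc s) i" for i
  proof -
    have "?L i - c (Suc s) i \<le> (\<Sum>r=Suc (Suc s)..k. c r j)" if j: "j \<in> atm (Suc s) i" for j
    proof -
      have "j \<in> atm s i"
        using j atom_of_mono[OF refining[OF s]] by auto
      then have "?L i = ?L j"
        using const_on_atomsD[OF p_const[OF s] j] const_on_atomsD[OF q_const[OF s] j]
          const_on_atomsD[OF \<Gamma>_const[OF s]] atom_of_eq[OF partition[OF s'']] by simp
      also have "\<dots> \<le> (\<Sum>r=Suc s..k. c r j)"
        using bound[OF s, of j] by (simp add: c_def)
      also have "\<dots> = c (Suc s) i + (\<Sum>r=Suc (Suc s)..k. c r j)"
        using s' const_on_atomsD[OF c_const[OF s'] j] by (simp add: sum.atLeast_Suc_atMost)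
      finally show ?thesis by simp
    qed
    then have "?L i - c (Suc s) i \<le> d (Suc s) i"
      using good by (auto simp: good_def)
    then show ?thesis by simp
  qed
  then show "?L i \<le> c (Suc s) i + d (Suc s) i" .
  have const: "\<Gamma> s j = \<Gamma> s i" "atm s j = atm s i" if "j \<in> atm s i" for j
    using that const_on_atomsD[OF \<Gamma>_const[OF s]] atom_of_eq[OF partition[OF s'']] by auto
  show "\<Gamma> s i * (\<Sum>j\<in>atm s i. p s j * u (Suc s) j) \<le> 1"
  proof (rule mult_sum_div_le_1)
    show "\<Gamma> s i * sum (p s) (atm s i) \<le> c (Suc s) j + d (Suc s) j"
      if "j \<in> atm s i" "p s j = 1" for j
      using le[of j] const[OF that(1)] pq[OF s, of j] that(2) by simp
  qed (use pq[OF s] pos in auto)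
  show "\<Gamma> s i * (\<Sum>j\<in>atm s i. q s j * u (Suc s) j) \<le> 1"
  proof (rule mult_sum_div_le_1)
    show "\<Gamma> s i * sum (q s) (atm s i) \<le> c (Suc s) j + d (Suc s) j"
      if "j \<in> atm s i" "q s j = 1" for j
      using le[of j] const[OF that(1)] pq[OF s, of j] that(2) by simp
  qed (use pq[OF s] pos in auto)
qed

text \<open>The correction \<open>\<Gamma> s i * A * B\<close> lies between 0 and the smaller of
  \<open>A\<close> and \<open>B\<close>, whose sum is positive. So \<open>d s\<close> is finite,
  positive and at least a harmonic mean.\<close>

lemma mass_bounds:
  assumes s: "s < k" and good: "good (Suc s)"
  shows "0 < mass s (u (Suc s)) i" and "mass s (u (Suc s)) i \<le> sum (u (Suc s)) (atm s i)"
proof -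
  note bnd = good_step_bounds[OF s good]
  define A B where "A = (\<Sum>j\<in>atm s i. p s j * u (Suc s) j)"
    and "B = (\<Sum>j\<in>atm s i. q s j * u (Suc s) j)"
  have u_pos: "0 < u (Suc s) j" for j
    using bnd(1) by simp
  have pq_nonneg: "0 \<le> p s j" "0 \<le> q s j" for j
    using pq[OF s, of j] by auto
  have A: "0 \<le> A"
    unfolding A_def by (intro sum_nonneg mult_nonneg_nonneg pq_nonneg less_imp_le[OF u_pos])
  have B: "0 \<le> B"
    unfolding B_def by (intro sum_nonneg mult_nonneg_nonneg pq_nonneg less_imp_le[OF u_pos])
  have sum_AB: "sum (u (Suc s)) (atm s i) = A + B"
    unfolding A_def B_def sum.distrib[symmetric]
  proof (rule sum.cong[OF refl])
    show "u (Suc s) j = p s j * u (Suc s) j + q s j * u (Suc s) j" for j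
      using pq[OF s, of j] by auto
  qed
  have mass: "mass s (u (Suc s)) i = A + B - \<Gamma> s i * A * B"
    unfolding mass_def sum_AB by (simp add: A_def B_def)
  have "0 < A + B"
    unfolding sum_AB[symmetric] using u_pos card_atm_pos[of s i] s
    by (intro sum_pos) (auto simp: card_gt_0_iff)
  moreover have "\<Gamma> s i * A * B \<le> B" "\<Gamma> s i * A * B \<le> A"
    using mult_right_mono[OF bnd(3) B, of i] mult_right_mono[OF bnd(4) A, of i]
    by (simp_all add: A_def B_def mult_ac)
  ultimately show "0 < mass s (u (Suc s)) i"
    unfolding mass by linarith
  show "mass s (u (Suc s)) i \<le> sum (u (Suc s)) (atm s i)"
    unfolding mass sum_AB using A B \<Gamma>_nonneg[OF s, of i] by simp
qed

lemma good: "s \<le> k \<Longrightarrow> good s"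
proof (induction rule: inc_induct)
  case base
  \<comment> \<open>The sum over \<open>Suc k..k\<close> is empty, so only \<open>K \<le> 0\<close>
    has to be compared with \<open>d k = 1\<close>.\<close>
  show ?case
    by (auto simp: good_def d_last atm_last const_on_atoms_def)
next
  case (step s)
  note s = \<open>s < k\<close>
  note mass = mass_bounds[OF s step.IH]
  have N: "0 < real (card (atm s i))" for i
    using card_atm_pos[of s i] s by simp
  have pos: "0 < d s i" for i
    using mass(1) N by (simp add: d_step[OF s])
  have "const_on_atoms (R s) (d s)"
    using s by (intro const_on_atomsI)
      (simp add: d_step const_on_atomsD[OF mass_const] atom_of_eq[OF partition[of s]])
  moreover have "K \<le> d s i" if K: "\<And>j. j \<in> atm s i \<Longrightarrow> K \<le> (\<Sum>r=Suc s..k. c r j)" for i K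
  proof (cases "K \<le> 0")
    case True
    then show ?thesis using pos[of i] by simp
  next
    case False
    \<comment> \<open>\<open>K - c (Suc s) j\<close> is a constant lower bound on the finer atom, so
      the induction hypothesis gives \<open>K \<le> c (Suc s) j + d (Suc s) j\<close>.\<close>
    have "u (Suc s) j \<le> 1 / K" if j: "j \<in> atm s i" for j
    proof -
      have "K - c (Suc s) j \<le> (\<Sum>r=Suc (Suc s)..k. c r m)" if m: "m \<in> atm (Suc s) j" for m
      proof -
        have "m \<in> atm s i"
          using m atom_of_mono[OF refining[OF s]] atom_of_eq[OF partition j] s by auto
        then have "K \<le> c (Suc s) m + (\<Sum>r=Suc (Suc s)..k. c r m)"
          using K s by (simp add: sum.atLeast_Suc_atMost)
        then show ?thesis
          using const_on_atomsD[OF c_const m] s by simp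
      qed
      then have "K - c (Suc s) j \<le> d (Suc s) j"
        using step.IH by (auto simp: good_def)
      then show ?thesis
        using False by (simp add: frac_le)
    qed
    then have "sum (u (Suc s)) (atm s i) \<le> card (atm s i) * (1 / K)"
      by (rule sum_bounded_above)
    with mass(2)[of i] have "mass s (u (Suc s)) i \<le> card (atm s i) / K"
      by simp
    then show ?thesis
      using mass(1)[of i] False by (simp add: d_step[OF s] field_simps)
  qed
  ultimately show ?case
    using pos by (auto simp: good_def)
qed

lemma d_pos: "s \<le> k \<Longrightarrow> 0 < d s i"
  using good by (simp add: good_def)

section \<open>Inverses of the partial sums\<close>

definition V :: "nat \<Rightarrow> 'n \<Rightarrow> 'n \<Rightarrow> real"
  where "V s i j = of_bool (i = j) +
    (\<Sum>r=s..k. if j \<in> atm r i then C r i + \<Gamma> r i * p r i * q r j else 0)"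

text \<open>The mass equation ties the inverse to the recursion: it is what
  \<open>block_potential_step\<close> requires at the next level.\<close>

lemma block_potential_V:
  "s \<le> k \<Longrightarrow> \<exists>G. block_potential (R s) (V s) G \<and>
    (\<forall>i. (\<Sum>j\<in>atm s i. \<Sum>l\<in>UNIV. G j l) = card (atm s i) * u s i)"
proof (induction rule: inc_induct)
  case base
  \<comment> \<open>On singletons \<open>V k\<close> is diagonal, because \<open>\<Gamma> k\<close>
    vanishes; the identity summand is what \<open>d k = 1\<close> records.\<close>
  define G where "G i j = of_bool (i = j) / (1 + C k i)" for i j
  have pos: "0 < 1 + C k i" for i
    using C_nonneg[of k i] by simp
  have V: "V k i j = of_bool (i = j) * (1 + C k i)" for i j
    by (auto simp: V_def atm_last \<Gamma>_last)
  have mult: "of_bool b * x = (if b then x else 0)" "of_bool b / x = (if b then 1 / x else 0)"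
    for b and x :: real
    by auto
  have "block_potential (R k) (V k) G"
    using pos less_imp_le[OF pos] less_imp_neq[OF pos]
    by (auto simp: block_potential_def V G_def atm_last mult if_distrib[of "\<lambda>x. _ * x"]
        if_distrib[of "\<lambda>x. x * _"] cong: if_cong)
  moreover have "(\<Sum>l\<in>UNIV. G i l) = u k i" for i
    by (simp add: G_def mult c_def atm_last d_last add.commute)
  ultimately show ?case
    by (auto simp: atm_last)
next
  case (step s)
  note s = \<open>s < k\<close>
  have s': "s \<le> k" "Suc s \<le> k"
    using s by auto
  obtain G where G: "block_potential (R (Suc s)) (V (Suc s)) G"
      "\<And>i. (\<Sum>j\<in>atm (Suc s) i. \<Sum>l\<in>UNIV. G j l) = card (atm (Suc s) i) * u (Suc s) i"
    using step.IH by blast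
  note bnd = good_step_bounds[OF s good[OF s'(2)]]
  obtain G' where G': "block_potential (R s)
      (\<lambda>i j. V (Suc s) i j + (if j \<in> atm s i then C s i + \<Gamma> s i * p s i * q s j else 0)) G'"
    and mass: "\<And>i. (\<Sum>j\<in>atm s i. \<Sum>l\<in>UNIV. G' j l)
      = mass s (u (Suc s)) i / (1 + C s i * mass s (u (Suc s)) i)"
    using block_potential_step[OF partition[OF s'(2)] partition[OF s'(1)] refining[OF s] G
        pq[OF s] p_const[OF s] q_const[OF s] C_const[OF s'(1)] C_nonneg[OF s'(1)]
        \<Gamma>_const[OF s] \<Gamma>_nonneg[OF s] bnd(3,4), of "mass s (u (Suc s))"]
    unfolding mass_def by blast
  have "(\<lambda>i j. V (Suc s) i j + (if j \<in> atm s i then C s i + \<Gamma> s i * p s i * q s j else 0)) = V s"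
    using s'(1) by (simp add: fun_eq_iff V_def sum.atLeast_Suc_atMost[of s k])
  \<comment> \<open>Both \<open>c s\<close> and \<open>d s\<close> carry the atom size as a factor,
    so adding \<open>C s\<close> to the reciprocal of the mass turns \<open>d s\<close> into
    \<open>c s + d s\<close>.\<close>
  moreover have "mass s (u (Suc s)) i / (1 + C s i * mass s (u (Suc s)) i) = card (atm s i) * u s i" for i
  proof -
    have m: "0 < mass s (u (Suc s)) i"
      by (rule mass_bounds(1)[OF s good[OF s'(2)]])
    have "c s i + d s i = card (atm s i) * (1 + C s i * mass s (u (Suc s)) i) / mass s (u (Suc s)) i"
      using m by (simp add: c_def d_step[OF s] field_simps)
    then show ?thesis
      using card_atm_pos[OF s'(1), of i] by auto
  qed
  ultimately show ?case
    using G' mass by auto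
qed

end

subsection \<open>Bi-potentials and their limits\<close>

text \<open>If a diagonal entry of \<open>G\<close> were nonpositive, its whole row would be, and
  that diagonal entry of \<open>G ** V\<close> could not be 1.\<close>

lemma bi_potentialI:
  fixes V G :: "real ^ 'n::finite ^ 'n"
  assumes V: "\<And>i j. 0 \<le> V $ i $ j" and VG: "V ** G = mat 1"
    and off: "\<And>i j. i \<noteq> j \<Longrightarrow> G $ i $ j \<le> 0"
    and row: "\<And>i. 0 \<le> (\<Sum>j\<in>UNIV. G $ i $ j)" and col: "\<And>j. 0 \<le> (\<Sum>i\<in>UNIV. G $ i $ j)"
  shows "bi_potential V"
proof -
  have GV: "G ** V = mat 1"
    using VG matrix_left_right_inverse by blast
  have "0 < G $ i $ i" for i
  proof (rule ccontr)
    assume "\<not> 0 < G $ i $ i"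
    then have "G $ i $ j \<le> 0" for j
      using off[of i j] by (cases "i = j") auto
    then have "(G ** V) $ i $ i \<le> 0"
      using V by (auto simp: matrix_matrix_mult_def intro!: sum_nonpos mult_nonpos_nonneg)
    then show False
      by (simp add: GV mat_def)
  qed
  moreover have "invertible V"
    using VG GV by (auto simp: invertible_def)
  ultimately show ?thesis
    using assms matrix_inv_eqI[OF VG] by (simp add: bi_potential_def)
qed

lemma matrix_inv_right_real:
  fixes A :: "real ^ 'n::finite ^ 'n"
  assumes "invertible A"
  shows "A ** matrix_inv A = mat 1"
  using assms matrix_inv_eqI by (auto simp: invertible_def)

text \<open>As quotients of determinants, the entries of the inverse are visibly continuous.\<close>

lemma matrix_inv_nth_cramer:
  fixes A :: "real ^ 'n::finite ^ 'n"
  assumes "invertible A"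
  shows "matrix_inv A $ i $ j
    = det (\<chi> r s. if s = i then axis j 1 $ r else A $ r $ s) / det A"
proof -
  have "A *v (matrix_inv A *v axis j 1) = axis j 1"
    by (simp add: matrix_vector_mul_assoc matrix_inv_right_real[OF assms])
  then have "matrix_inv A *v axis j 1
      = (\<chi> i. det (\<chi> r s. if s = i then axis j 1 $ r else A $ r $ s) / det A)"
    using assms by (simp add: cramer invertible_det_nz)
  moreover have "(matrix_inv A *v axis j 1) $ i = matrix_inv A $ i $ j"
    by (simp add: matrix_vector_mult_basis column_def)
  ultimately show ?thesis
    by simp
qed

lemma tendsto_det:
  fixes A :: "'a \<Rightarrow> real ^ 'n::finite ^ 'n"
  assumes "\<And>i j. ((\<lambda>x. A x $ i $ j) \<longlongrightarrow> L $ i $ j) F"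
  shows "((\<lambda>x. det (A x)) \<longlongrightarrow> det L) F"
  unfolding det_def by (intro tendsto_intros assms)

lemma tendsto_matrix_inv_nth:
  fixes A :: "'a \<Rightarrow> real ^ 'n::finite ^ 'n"
  assumes lim: "\<And>i j. ((\<lambda>x. A x $ i $ j) \<longlongrightarrow> L $ i $ j) F"
    and inv: "\<And>x. invertible (A x)" "invertible L"
  shows "((\<lambda>x. matrix_inv (A x) $ i $ j) \<longlongrightarrow> matrix_inv L $ i $ j) F"
  unfolding matrix_inv_nth_cramer[OF inv(1)] matrix_inv_nth_cramer[OF inv(2)]
  using inv(2) lim by (intro tendsto_divide tendsto_det) (auto simp: invertible_det_nz)

text \<open>Along \<open>t = Suc n\<close>, the matrices \<open>B n\<close> are \<open>U\<close>
  plus a vanishing multiple of the identity. The weak inequalities survive the limit, and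
  \<open>bi_potentialI\<close> restores the strict one.\<close>

lemma bi_potential_of_resolvents:
  fixes U :: "real ^ 'n::finite ^ 'n"
  assumes U: "invertible U" "\<And>i j. 0 \<le> U $ i $ j"
    and pot: "\<And>t. 0 \<le> t \<Longrightarrow> bi_potential (mat 1 + t *\<^sub>R U)"
  shows "bi_potential U"
proof -
  define A where "A n = mat 1 + real (Suc n) *\<^sub>R U" for n
  define B where "B n = inverse (real (Suc n)) *\<^sub>R A n" for n
  have A: "bi_potential (A n)" for n
    unfolding A_def by (rule pot) simp
  have BA: "B n ** (real (Suc n) *\<^sub>R matrix_inv (A n)) = mat 1" for n
    using A[of n] by (simp add: B_def bi_potential_def matrix_inv_right_real matrix_scalar_ac
        flip: scalar_matrix_assoc)
  have B_inv: "matrix_inv (B n) $ i $ j = real (Suc n) * matrix_inv (A n) $ i $ j" for n i j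
    by (simp add: matrix_inv_eqI[OF BA])
  have B_invertible: "invertible (B n)" for n
    using BA matrix_left_right_inverse by (auto simp: invertible_def)
  have "(\<lambda>n. inverse (real (Suc n)) * mat 1 $ i $ j + U $ i $ j) \<longlonglongrightarrow> 0 * mat 1 $ i $ j + U $ i $ j"
    for i j :: 'n
    by (intro tendsto_intros LIMSEQ_inverse_real_of_nat)
  moreover have "B n $ i $ j = inverse (real (Suc n)) * mat 1 $ i $ j + U $ i $ j" for n i j
    by (simp add: B_def A_def field_simps del: of_nat_Suc)
  ultimately have "(\<lambda>n. B n $ i $ j) \<longlonglongrightarrow> U $ i $ j" for i j
    by simp
  then have lim: "(\<lambda>n. matrix_inv (B n) $ i $ j) \<longlonglongrightarrow> matrix_inv U $ i $ j" for i j
    using B_invertible U(1) by (rule tendsto_matrix_inv_nth)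
  show ?thesis
  proof (rule bi_potentialI[OF U(2) matrix_inv_right_real[OF U(1)]])
    fix i j :: 'n
    assume "i \<noteq> j"
    then have "matrix_inv (B n) $ i $ j \<le> 0" for n
      using A[of n] by (simp add: B_inv bi_potential_def mult_nonneg_nonpos del: of_nat_Suc)
    then show "matrix_inv U $ i $ j \<le> 0"
      by (intro LIMSEQ_le_const2[OF lim]) blast
  next
    fix i :: 'n
    have "0 \<le> (\<Sum>j\<in>UNIV. matrix_inv (B n) $ i $ j)" for n
      using A[of n] by (simp add: B_inv bi_potential_def del: of_nat_Suc flip: sum_distrib_left)
    moreover have "(\<lambda>n. \<Sum>j\<in>UNIV. matrix_inv (B n) $ i $ j) \<longlonglongrightarrow> (\<Sum>j\<in>UNIV. matrix_inv U $ i $ j)"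
      by (intro tendsto_sum lim)
    ultimately show "0 \<le> (\<Sum>j\<in>UNIV. matrix_inv U $ i $ j)"
      by (intro LIMSEQ_le_const) auto
  next
    fix j :: 'n
    have "0 \<le> (\<Sum>i\<in>UNIV. matrix_inv (B n) $ i $ j)" for n
      using A[of n] by (simp add: B_inv bi_potential_def del: of_nat_Suc flip: sum_distrib_left)
    moreover have "(\<lambda>n. \<Sum>i\<in>UNIV. matrix_inv (B n) $ i $ j) \<longlonglongrightarrow> (\<Sum>i\<in>UNIV. matrix_inv U $ i $ j)"
      by (intro tendsto_sum lim)
    ultimately show "0 \<le> (\<Sum>i\<in>UNIV. matrix_inv U $ i $ j)"
      by (intro LIMSEQ_le_const) auto
  qed
qed

section \<open>Return from index functions to vectors and matrices\<close>

lemma block_potential_imp_bi_potential: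
  assumes "block_potential R (\<lambda>i j. V $ i $ j) G" and "\<And>i j. 0 \<le> V $ i $ j"
  shows "bi_potential V"
  by (rule bi_potentialI[of _ "\<chi> i j. G i j"])
    (use assms in \<open>auto simp: block_potential_def vec_eq_iff matrix_matrix_mult_def mat_def\<close>)

text \<open>The constructed \<open>d\<close> is finite, so every extended expectation in the
  recursion reduces to a real average.\<close>

lemma cond_exp_ereal_ereal:
  assumes "partition_on UNIV R" and "\<And>j. w $ j = ereal (v j)"
  shows "cond_exp_ereal R w $ i = ereal (sum v (atom_of R i) / card (atom_of R i))"
  using sum_of_bool_atom[of R i v]
  by (simp add: cond_exp_ereal_def cond_exp_mat_nth assms flip: sum_divide_distrib)

theorem corollary5p2:
  fixes U :: "real ^ 'n::finite ^ 'n"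
    and k :: nat
    and R :: "nat \<Rightarrow> 'n set set"
    and C \<Gamma> p q c \<gamma> \<rho> :: "nat \<Rightarrow> real ^ 'n"
  assumes filtration: "filtration k R"
    and R_0: "R 0 = {UNIV}"
    and R_k: "R k = range (\<lambda>i. {i})"
    and C: "\<And>s. s \<le> k \<Longrightarrow> C s \<ge> 0 \<and> meas_vec (R s) (C s)"
    and \<Gamma>: "\<And>s. s \<le> k \<Longrightarrow> \<Gamma> s \<ge> 0 \<and> meas_vec (R s) (\<Gamma> s)"
    and \<Gamma>_k: "\<Gamma> k = 0"
    and pq: "\<And>s. s < k \<Longrightarrow> meas_partition (R (Suc s)) (p s) (q s)"
    and U: "U = (\<Sum>s\<le>k. diag_mat (C s) ** part_mat (R s)
                   + diag_mat (\<Gamma> s) ** diag_mat (p s) ** part_mat (R s) ** diag_mat (q s))"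
    and c: "\<And>s. s \<le> k \<Longrightarrow> c s = C s * (part_mat (R s) *v 1)"
    and \<gamma>: "\<And>s. s \<le> k \<Longrightarrow> \<gamma> s = \<Gamma> s * (part_mat (R s) *v 1)"
    and \<rho>: "\<And>s. s < k \<Longrightarrow>
      \<rho> s = (cond_exp_mat (R s) *v p s) * p s + (cond_exp_mat (R s) *v q s) * q s"
    and bound: "\<And>s. s < k \<Longrightarrow> \<rho> s * \<gamma> s \<le> (\<Sum>r=Suc s..k. c r)"
  shows "(\<exists>d :: nat \<Rightarrow> ereal ^ 'n.
        d k = 1
      \<and> (\<forall>s<k. vec_quot 1 (d s) =
            cond_exp_ereal (R s) (vec_quot 1 (ereal_vec (c (Suc s)) + d (Suc s)))
            - ereal_vec (\<gamma> s)
              * cond_exp_ereal (R s) (vec_quot (ereal_vec (p s)) (ereal_vec (c (Suc s)) + d (Suc s)))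
              * cond_exp_ereal (R s) (vec_quot (ereal_vec (q s)) (ereal_vec (c (Suc s)) + d (Suc s))))
      \<and> (\<forall>s\<le>k. d s \<ge> 0)
      \<and> (\<forall>s<k. ereal_vec (\<rho> s * \<gamma> s) \<le> ereal_vec (c (Suc s)) + d (Suc s)))
    \<and> (\<forall>t::real. t \<ge> 0 \<longrightarrow> bi_potential (mat 1 + t *\<^sub>R U))
    \<and> (invertible U \<longrightarrow> bi_potential U)"
proof -
  have part: "partition_on UNIV (R s)" if "s \<le> k" for s
    using filtration that by (simp add: filtration_def)
  have ref: "refines UNIV (R (Suc s)) (R s)" if "s < k" for s
    using filtration that by (simp add: filtration_def strictly_coarser_def)
  have C_nonneg: "0 \<le> C s $ i" and \<Gamma>_nonneg: "0 \<le> \<Gamma> s $ i" if "s \<le> k" for s i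
    using C[OF that] \<Gamma>[OF that] by (auto simp: less_eq_vec_def)
  have pq_cases: "p s $ i = 0 \<and> q s $ i = 1 \<or> p s $ i = 1 \<and> q s $ i = 0" if "s < k" for s i
  proof -
    have "p s $ i = 0 \<or> p s $ i = 1" "p s $ i + q s $ i = 1"
      using pq[OF that] by (auto simp: meas_partition_def vec_eq_iff)
    then show ?thesis by auto
  qed
  have c_nth: "c s $ i = C s $ i * card (atom_of (R s) i)"
    and \<gamma>_nth: "\<gamma> s $ i = \<Gamma> s $ i * card (atom_of (R s) i)" if "s \<le> k" for s i
    by (simp_all add: c[OF that] \<gamma>[OF that] part_mat_mult_vec_nth)
  have \<rho>\<gamma>_nth: "(\<rho> s * \<gamma> s) $ i = \<Gamma> s $ i *
      (p s $ i * sum (($) (p s)) (atom_of (R s) i) + q s $ i * sum (($) (q s)) (atom_of (R s) i))"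
    if s: "s < k" for s i
    using part[of s] card_atom_of_pos[of "R s" i] s
    by (simp add: \<rho> \<gamma>_nth cond_exp_mat_mult_vec_nth field_simps)
  have bound_nth: "\<Gamma> s $ i *
      (p s $ i * sum (($) (p s)) (atom_of (R s) i) + q s $ i * sum (($) (q s)) (atom_of (R s) i))
      \<le> (\<Sum>r=Suc s..k. C r $ i * card (atom_of (R r) i))" if s: "s < k" for s i
  proof -
    have "(\<rho> s * \<gamma> s) $ i \<le> (\<Sum>r=Suc s..k. c r) $ i"
      using bound[OF s] by (simp add: less_eq_vec_def)
    also have "\<dots> = (\<Sum>r=Suc s..k. C r $ i * card (atom_of (R r) i))"
      by (simp add: c_nth)
    finally show ?thesis
      by (simp only: \<rho>\<gamma>_nth[OF s])
  qed
  \<comment> \<open>\<open>bound\<close> is homogeneous of degree one in \<open>C\<close> and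
    \<open>\<Gamma>\<close> jointly, so \<open>t U\<close> inherits the hypotheses with the same
    \<open>p\<close> and \<open>q\<close>.\<close>
  have fm: "filtered_matrix k R (\<lambda>s i. t * C s $ i) (\<lambda>s i. t * \<Gamma> s $ i) (\<lambda>s. ($) (p s)) (\<lambda>s. ($) (q s))"
    if t: "0 \<le> t" for t
  proof
    show "const_on_atoms (R s) (\<lambda>i. t * C s $ i)" if "s \<le> k" for s
      using C[OF that] by (simp add: const_on_atoms_def flip: const_on_atoms_iff_meas_vec)
    show "const_on_atoms (R s) (\<lambda>i. t * \<Gamma> s $ i)" if "s < k" for s
      using \<Gamma>[of s] that by (simp add: const_on_atoms_def flip: const_on_atoms_iff_meas_vec)
    show "const_on_atoms (R (Suc s)) (($) (p s))" "const_on_atoms (R (Suc s)) (($) (q s))"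
      if "s < k" for s
      using pq[OF that] by (simp_all add: const_on_atoms_iff_meas_vec meas_partition_def)
    show "t * \<Gamma> s $ i * (p s $ i * sum (($) (p s)) (atom_of (R s) i)
        + q s $ i * sum (($) (q s)) (atom_of (R s) i))
      \<le> (\<Sum>r=Suc s..k. t * C r $ i * card (atom_of (R r) i))" if "s < k" for s i
      using mult_left_mono[OF bound_nth[OF that] t] by (simp add: sum_distrib_left mult.assoc)
  qed (use t part ref C_nonneg \<Gamma>_nonneg pq_cases R_k \<Gamma>_k in auto)

  have U_nth: "U $ i $ j = (\<Sum>s\<le>k. if j \<in> atom_of (R s) i
      then C s $ i + \<Gamma> s $ i * p s $ i * q s $ j else 0)" for i j
    unfolding U sum_component
    by (intro sum.cong refl) (simp add: diag_mat_mult_nth mult_diag_mat_nth part_mat_nth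
        flip: matrix_mul_assoc)
  have U_nonneg: "0 \<le> U $ i $ j" for i j
    unfolding U_nth
  proof (intro sum_nonneg)
    fix s assume "s \<in> {..k}"
    then have s: "s \<le> k" by simp
    \<comment> \<open>At \<open>s = k\<close> nothing is known about the signs of \<open>p\<close>
      and \<open>q\<close>, but \<open>\<Gamma> k\<close> is zero.\<close>
    have "0 \<le> \<Gamma> s $ i * p s $ i * q s $ j"
      using pq_cases[of s i] pq_cases[of s j] \<Gamma>_nonneg[OF s, of i] \<Gamma>_k s
      by (cases "s = k") auto
    then show "0 \<le> (if j \<in> atom_of (R s) i then C s $ i + \<Gamma> s $ i * p s $ i * q s $ j else 0)"
      using C_nonneg[OF s, of i] by simp
  qed
  have pot: "bi_potential (mat 1 + t *\<^sub>R U)" if t: "0 \<le> t" for t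
  proof -
    interpret filtered_matrix k R "\<lambda>s i. t * C s $ i" "\<lambda>s i. t * \<Gamma> s $ i" "\<lambda>s. ($) (p s)" "\<lambda>s. ($) (q s)"
      by (rule fm[OF t])
    obtain G where "block_potential (R 0) (V 0) G"
      using block_potential_V[of 0] by auto
    moreover have "V 0 = (\<lambda>i j. (mat 1 + t *\<^sub>R U) $ i $ j)"
      unfolding V_def by (auto simp: fun_eq_iff U_nth mat_def sum_distrib_left atMost_atLeast0
          algebra_simps intro!: sum.cong)
    ultimately show ?thesis
      using t U_nonneg by (intro block_potential_imp_bi_potential) (auto simp: mat_def)
  qed

  interpret filtered_matrix k R "\<lambda>s. ($) (C s)" "\<lambda>s. ($) (\<Gamma> s)" "\<lambda>s. ($) (p s)" "\<lambda>s. ($) (q s)"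
    using fm[of 1] by simp
  \<comment> \<open>Here \<open>c\<close> is the vector of the theorem, which hides the function
    \<open>c\<close> of the locale.\<close>
  have c_eq: "filtered_matrix.c R (\<lambda>s. ($) (C s)) s i = c s $ i" if "s \<le> k" for s i
    by (simp add: c_def c_nth[OF that])
  define D :: "nat \<Rightarrow> ereal ^ 'n" where "D s = (\<chi> i. ereal (d s i))" for s
  have x_pos: "0 < c s $ i + d s i" if "s \<le> k" for s i
    using c_nonneg[OF that, of i] d_pos[OF that, of i] c_eq[OF that, of i] by simp
  have quot: "vec_quot (ereal_vec v) (ereal_vec (c s) + D s) $ j = ereal (v $ j * (1 / (c s $ j + d s j)))"
    if "s \<le> k" for s v j
    using x_pos[OF that, of j] by (simp add: vec_quot_def ereal_vec_def D_def)
  have one: "1 = ereal_vec (1 :: real ^ 'n)"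
    by (simp add: vec_eq_iff ereal_vec_def)
  have rec: "vec_quot 1 (D s) =
      cond_exp_ereal (R s) (vec_quot 1 (ereal_vec (c (Suc s)) + D (Suc s)))
      - ereal_vec (\<gamma> s)
        * cond_exp_ereal (R s) (vec_quot (ereal_vec (p s)) (ereal_vec (c (Suc s)) + D (Suc s)))
        * cond_exp_ereal (R s) (vec_quot (ereal_vec (q s)) (ereal_vec (c (Suc s)) + D (Suc s)))"
    if s: "s < k" for s
  proof -
    have s': "s \<le> k" "Suc s \<le> k"
      using s by auto
    note ce = cond_exp_ereal_ereal[OF part[OF s'(1)] quot[OF s'(2)]]
    have "1 / d s i = mass s (u (Suc s)) i / card (atm s i)" for i
      by (simp add: d_step[OF s])
    \<comment> \<open>Since \<open>\<gamma>\<close> is \<open>\<Gamma>\<close> times the atom size,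
      one division by that size becomes two averages in the product term.\<close>
    then have "1 / d s i = sum (u (Suc s)) (atm s i) / card (atm s i)
        - \<gamma> s $ i * ((\<Sum>j\<in>atm s i. p s $ j * u (Suc s) j) / card (atm s i))
          * ((\<Sum>j\<in>atm s i. q s $ j * u (Suc s) j) / card (atm s i))" for i
      using card_atm_pos[OF s'(1), of i]
      by (simp add: mass_def \<gamma>_nth[OF s'(1)] field_simps)
    then show ?thesis
      using d_pos[OF s'(1)] unfolding one
      by (simp add: vec_eq_iff ce c_eq[OF s'(2)])
        (simp add: vec_quot_def ereal_vec_def D_def less_imp_neq[symmetric])
  qed
  have "ereal_vec (\<rho> s * \<gamma> s) \<le> ereal_vec (c (Suc s)) + D (Suc s)" if s: "s < k" for s
    using good_step_bounds(2)[OF s good] s c_eq[of "Suc s"]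
    by (simp add: less_eq_vec_def ereal_vec_def D_def \<rho>\<gamma>_nth[OF s] del: vector_mult_component)
  moreover have "D k = 1"
    by (simp add: vec_eq_iff D_def d_last)
  moreover have "0 \<le> D s" if "s \<le> k" for s
    using d_pos[OF that] by (simp add: less_eq_vec_def D_def less_imp_le)
  ultimately show ?thesis
    using rec pot bi_potential_of_resolvents[OF _ U_nonneg pot] by blast
qed

end
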